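(* Let $f\colon\mathbb{R}^n\to\mathbb{R}$ and $c\colon\mathbb{R}^n\to\mathbb{R}^m$ be continuously differentiable, and let $\{x^k,y^k,z^k\}$ be a sequence of iterates generated by the regularized interior point algorithm described in the context with termination tolerance $\varepsilon=0$. Then each limit point $x^\ast$ of $\{x^k\}$ is KKT stationary for the problem $$\text{minimize over } x\ge 0:\quad \tfrac12\|c(x)\|^2,$$ that is, there exists $\tilde z^\ast\in\mathbb{R}^n$ such that $\nabla c(x^\ast)^\top c(x^\ast)+\tilde z^\ast=0$, $x^\ast\ge0$, $\tilde z^\ast\le0$ and $\min\{x^\ast,-\tilde z^\ast\}=0$ (componentwise).
   Context: Notation: $\|\cdot\|$ is the Euclidean norm; $\nabla c(x)\in\mathbb{R}^{m\times n}$ is the Jacobian of $c$; vector inequalities and $\min$ of vectors are componentwise. A limit point of $\{x^k\}$ is the limit of some subsequence (so the algorithm is understood to generate an infinite sequence). Problem (P): minimize $f(x)$ over $x\in\mathbb{R}^n$ subject to $c(x)=0$, $x\ge 0$. $\varepsilon$-KKT stationarity for (P) ($\varepsilon\ge0$): $x^\ast$ is $\varepsilon$-KKT stationary, with multipliers $y^\ast\in\mathbb{R}^m$, $z^\ast\in\mathbb{R}^n$, if $\|\nabla f(x^\ast)+\nabla c(x^\ast)^\top y^\ast+z^\ast\|\le\varepsilon$, $\|c(x^\ast)\|\le\varepsilon$, $x^\ast\ge-\varepsilon$, $z^\ast\le\varepsilon$, $\min\{x^\ast,-z^\ast\}\le\varepsilon$. KKT stationary means $\varepsilon=0$. For a problem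 with equality constraints only, minimize $F(w)$ subject to $G(w)=0$, $w$ is $\varepsilon$-KKT stationary with multiplier $y$ if $w$ lies in the domain of $F$, $\|\nabla F(w)+\nabla G(w)^\top y\|\le\varepsilon$ and $\|G(w)\|\le\varepsilon$. Barrier: for $i=1,\dots,n$, $b_i\colon\mathbb{R}\to\mathbb{R}\cup\{\infty\}$ has domain (set where it is finite) $(0,\infty)$, is continuously differentiable there, satisfies $b_i(t)\to\infty$ as $t\to0^+$ and $b_i'\le0$ on $(0,\infty)$. Put $b(x)=\sum_{i=1}^n b_i(x_i)$, with domain $(0,\infty)^n$. Regularized barrier subproblem $(S_k)$, for given $\rho_k,\mu_k>0$ and $\hat y^k\in\mathbb{R}^m$: $$\text{minimize over }(x,\lambda)\in\mathbb{R}^n\times\mathbb{R}^m:\ f(x)+\tfrac{\rho_k}{2}\|\lambda\|^2+\mu_k b(x)\quad\text{subject to } c(x)+\rho_k(\hat y^k-\lambda)=0 .$$ Algorithm. Data: $\epsilon_0,\rho_0,\mu_0>0$; $\kappa_\rho,\kappa_\mu,\kappa_\epsilon\in(0,1)$; $\theta_\rho,\theta_\mu\in[0,1)$; a nonempty bounded set $Y\subset\mathbb{R}^m$; a termination tolerance $\varepsilon\ge0$. For $k=0,1,2,\dots$: 1. Select $\hat y^k\in Y$. 2. Find an $\epsilon_k$-KKT stationary point $(x^k,\lambda^k)$ for $(S_k)$, with multiplier $y^k\in\mathbb{R}^m$. 3. Set $z^k=\mu_k\nabla b(x^k)$. 4. If $x^k$ is $\varepsilon$-KKT stationary for (P) with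 multipliers $y^k,z^k$, stop and return $(x^k,y^k,z^k)$. 5. Set $C^k=\|c(x^k)\|$ and $V^k=\|\min\{x^k,-z^k\}\|$. 6. If $k=0$ or $C^k\le\max\{\varepsilon,\theta_\rho C^{k-1}\}$, set $\rho_{k+1}=\rho_k$; otherwise select $\rho_{k+1}\in(0,\kappa_\rho\rho_k]$. 7. If $k=0$ or $V^k\le\max\{\varepsilon,\theta_\mu V^{k-1}\}$, set $\mu_{k+1}=\mu_k$; otherwise select $\mu_{k+1}\in(0,\kappa_\mu\mu_k]$. 8. Set $\epsilon_{k+1}=\max\{\varepsilon,\kappa_\epsilon\epsilon_k\}$. Standing assumption: the subproblems $(S_k)$ are well-posed for all $\mu_k\le\mu_0$, $\rho_k\le\rho_0$, $\hat y^k\in Y$, so that step 2 can always be carried out. *)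

theory Defs
  imports "HOL-Analysis.Analysis"
begin

definition C1_map :: "('a::real_normed_vector \<Rightarrow> 'b::real_normed_vector) \<Rightarrow> bool" where
  "C1_map g \<longleftrightarrow>
     (\<exists>g' :: 'a \<Rightarrow> 'a \<Rightarrow>\<^sub>L 'b.
        (\<forall>x. (g has_derivative blinfun_apply (g' x)) (at x)) \<and> continuous_on UNIV g')"

text \<open>Unspecified where \<open>g\<close> is not differentiable.\<close>

definition gradient :: "('a::real_inner \<Rightarrow> real) \<Rightarrow> 'a \<Rightarrow> 'a" where
  "gradient g x = (THE D. GDERIV g x :> D)"

lemma gradient_eqI:
  assumes "GDERIV g x :> D"
  shows "gradient g x = D"
  unfolding gradient_def
proof (rule the_equality)
  show "GDERIV g x :> D"
    by (fact assms)
next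
  fix E assume "GDERIV g x :> E"
  with assms have "(\<lambda>h. h \<bullet> D) = (\<lambda>h. h \<bullet> E)"
    unfolding gderiv_def by (rule has_derivative_unique)
  then show "E = D"
    by (metis (full_types) inner_commute vector_eq_ldot)
qed

definition KKT_stationary ::
  "real \<Rightarrow> (real^'n \<Rightarrow> real) \<Rightarrow> (real^'n \<Rightarrow> real^'m) \<Rightarrow> real^'n \<Rightarrow> real^'m \<Rightarrow> real^'n \<Rightarrow> bool" where
  "KKT_stationary \<epsilon> f c x y z \<longleftrightarrow>
     norm (gradient f x + transpose (jacobian c (at x)) *v y + z) \<le> \<epsilon> \<and>
     norm (c x) \<le> \<epsilon> \<and>
     (\<forall>i. x $ i \<ge> - \<epsilon>) \<and>
     (\<forall>i. z $ i \<le> \<epsilon>) \<and>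
     (\<forall>i. min (x $ i) (- (z $ i)) \<le> \<epsilon>)"

text \<open>
  Stationarity for: minimize \<open>F w\<close> subject to \<open>G w = 0\<close>.  Extended-valued functions take values in
  \<^typ>\<open>ereal\<close>; they are differentiated after composition with \<^const>\<open>real_of_ereal\<close>.
  The space of the variable \<open>w\<close> is an arbitrary Euclidean space, so that it can be a product; the
  transposed Jacobian is therefore written as the adjoint of the derivative, which for Cartesian
  spaces is the transposed Jacobian matrix (see the lemma below).
\<close>

definition eq_KKT_stationary ::
  "real \<Rightarrow> ('a::euclidean_space \<Rightarrow> ereal) \<Rightarrow> ('a \<Rightarrow> 'b::euclidean_space) \<Rightarrow> 'a \<Rightarrow> 'b \<Rightarrow> bool" where
  "eq_KKT_stationary \<epsilon> F G w y \<longleftrightarrow>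
     \<bar>F w\<bar> \<noteq> \<infinity> \<and>
     norm (gradient (\<lambda>v. real_of_ereal (F v)) w + adjoint (frechet_derivative G (at w)) y) \<le> \<epsilon> \<and>
     norm (G w) \<le> \<epsilon>"

lemma adjoint_frechet_derivative_eq_transpose_jacobian:
  fixes G :: "real^'n \<Rightarrow> real^'m"
  assumes "G differentiable (at w)"
  shows "adjoint (frechet_derivative G (at w)) y = transpose (jacobian G (at w)) *v y"
proof -
  have "frechet_derivative G (at w) = (\<lambda>h. jacobian G (at w) *v h)"
    using assms by (metis frechet_derivative_at jacobian_works)
  then show ?thesis
    by (simp add: adjoint_matrix)
qed

definition barrier :: "('n \<Rightarrow> real \<Rightarrow> ereal) \<Rightarrow> bool" where
  "barrier b \<longleftrightarrow>
     (\<forall>i. (\<forall>t. b i t \<noteq> - \<infinity>) \<and>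
          {t. b i t \<noteq> \<infinity>} = {0<..} \<and>
          (\<lambda>t. real_of_ereal (b i t)) C1_differentiable_on {0<..} \<and>
          (b i \<longlongrightarrow> \<infinity>) (at_right 0) \<and>
          (\<forall>t>0. deriv (\<lambda>t. real_of_ereal (b i t)) t \<le> 0))"

definition barrier_sum :: "('n \<Rightarrow> real \<Rightarrow> ereal) \<Rightarrow> real^'n \<Rightarrow> ereal" where
  "barrier_sum b x = (\<Sum>i\<in>UNIV. b i (x $ i))"

definition sub_objective ::
  "(real^'n \<Rightarrow> real) \<Rightarrow> ('n \<Rightarrow> real \<Rightarrow> ereal) \<Rightarrow> real \<Rightarrow> real \<Rightarrow> (real^'n) \<times> (real^'m) \<Rightarrow> ereal" where
  "sub_objective f b \<rho> \<mu> =
     (\<lambda>(x, l). ereal (f x + \<rho> / 2 * (norm l)\<^sup>2) + ereal \<mu> * barrier_sum b x)"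

definition sub_constraint ::
  "(real^'n \<Rightarrow> real^'m) \<Rightarrow> real \<Rightarrow> real^'m \<Rightarrow> (real^'n) \<times> (real^'m) \<Rightarrow> real^'m" where
  "sub_constraint c \<rho> yh = (\<lambda>(x, l). c x + \<rho> *\<^sub>R (yh - l))"

definition subproblem_stationary ::
  "(real^'n \<Rightarrow> real) \<Rightarrow> (real^'n \<Rightarrow> real^'m) \<Rightarrow> ('n \<Rightarrow> real \<Rightarrow> ereal) \<Rightarrow> real \<Rightarrow> real \<Rightarrow> real^'m
     \<Rightarrow> real \<Rightarrow> real^'n \<Rightarrow> real^'m \<Rightarrow> real^'m \<Rightarrow> bool" where
  "subproblem_stationary f c b \<rho> \<mu> yh \<epsilon> x l y \<longleftrightarrow>
     eq_KKT_stationary \<epsilon> (sub_objective f b \<rho> \<mu>) (sub_constraint c \<rho> yh) (x, l) y"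

text \<open>Well-posedness of the subproblems: approximate stationary points exist for every positive
  tolerance.\<close>

definition subproblems_well_posed ::
  "(real^'n \<Rightarrow> real) \<Rightarrow> (real^'n \<Rightarrow> real^'m) \<Rightarrow> ('n \<Rightarrow> real \<Rightarrow> ereal) \<Rightarrow> real \<Rightarrow> real
     \<Rightarrow> (real^'m) set \<Rightarrow> bool" where
  "subproblems_well_posed f c b \<rho>\<^sub>0 \<mu>\<^sub>0 Y \<longleftrightarrow>
     (\<forall>\<rho> \<mu> yh \<epsilon>. 0 < \<rho> \<longrightarrow> \<rho> \<le> \<rho>\<^sub>0 \<longrightarrow> 0 < \<mu> \<longrightarrow> \<mu> \<le> \<mu>\<^sub>0 \<longrightarrow> yh \<in> Y \<longrightarrow> 0 < \<epsilon> \<longrightarrow>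
        (\<exists>x l y. subproblem_stationary f c b \<rho> \<mu> yh \<epsilon> x l y))"

definition compl_violation :: "real^'n \<Rightarrow> real^'n \<Rightarrow> real" where
  "compl_violation x z = norm (\<chi> i. min (x $ i) (- (z $ i)))"

text \<open>
  An infinite run of the algorithm with termination tolerance \<open>tol\<close>: the sequences start at
  \<open>k = 0\<close> with the data \<open>\<rho> 0\<close>, \<open>\<mu> 0\<close>, \<open>\<epsilon> 0\<close>, and the termination test fails in every iteration.
\<close>

locale regularized_ip_run =
  fixes f :: "real^'n \<Rightarrow> real"
    and c :: "real^'n \<Rightarrow> real^'m"
    and b :: "'n \<Rightarrow> real \<Rightarrow> ereal"
    and tol :: real
    and \<kappa>\<^sub>\<rho> \<kappa>\<^sub>\<mu> \<kappa>\<^sub>\<epsilon> \<theta>\<^sub>\<rho> \<theta>\<^sub>\<mu> :: real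
    and Y :: "(real^'m) set"
    and \<rho> \<mu> \<epsilon> :: "nat \<Rightarrow> real"
    and yh :: "nat \<Rightarrow> real^'m"
    and x :: "nat \<Rightarrow> real^'n"
    and l :: "nat \<Rightarrow> real^'m"
    and y :: "nat \<Rightarrow> real^'m"
    and z :: "nat \<Rightarrow> real^'n"
  assumes tol_nonneg: "0 \<le> tol"
    and initial_pos: "0 < \<epsilon> 0" "0 < \<rho> 0" "0 < \<mu> 0"
    and kappa: "\<kappa>\<^sub>\<rho> \<in> {0<..<1}" "\<kappa>\<^sub>\<mu> \<in> {0<..<1}" "\<kappa>\<^sub>\<epsilon> \<in> {0<..<1}"
    and theta: "\<theta>\<^sub>\<rho> \<in> {0..<1}" "\<theta>\<^sub>\<mu> \<in> {0..<1}"
    and Y: "Y \<noteq> {}" "bounded Y"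
    and yh_in: "\<forall>k. yh k \<in> Y"
    and subproblem: "\<forall>k. subproblem_stationary f c b (\<rho> k) (\<mu> k) (yh k) (\<epsilon> k) (x k) (l k) (y k)"
    and z_eq: "\<forall>k. z k = \<mu> k *\<^sub>R gradient (\<lambda>u. real_of_ereal (barrier_sum b u)) (x k)"
    and no_termination: "\<forall>k. \<not> KKT_stationary tol f c (x k) (y k) (z k)"
    and rho_update: "\<forall>k.
      if k = 0 \<or> norm (c (x k)) \<le> max tol (\<theta>\<^sub>\<rho> * norm (c (x (k - 1))))
      then \<rho> (Suc k) = \<rho> k
      else \<rho> (Suc k) \<in> {0<..\<kappa>\<^sub>\<rho> * \<rho> k}"
    and mu_update: "\<forall>k.
      if k = 0 \<or> compl_violation (x k) (z k) \<le> max tol (\<theta>\<^sub>\<mu> * compl_violation (x (k - 1)) (z (k - 1)))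
      then \<mu> (Suc k) = \<mu> k
      else \<mu> (Suc k) \<in> {0<..\<kappa>\<^sub>\<mu> * \<mu> k}"
    and eps_update: "\<forall>k. \<epsilon> (Suc k) = max tol (\<kappa>\<^sub>\<epsilon> * \<epsilon> k)"

end

theory Submission
  imports Defs
begin

text \<open>
  Write \<open>J\<close> for the Jacobian of \<open>c\<close>. Both blocks of the stationarity condition of the subproblem,
  together with its constraint, give
  \<open>\<nabla>f(x\<^sub>k) + J(x\<^sub>k)\<^sup>T y\<^sub>k + z\<^sub>k = O(\<epsilon>\<^sub>k)\<close> and \<open>\<rho>\<^sub>k y\<^sub>k = c(x\<^sub>k) + \<rho>\<^sub>k yh\<^sub>k + O(\<epsilon>\<^sub>k)\<close>, where \<open>yh\<^sub>k\<close> is the bounded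
  multiplier estimate of the subproblem (lemma \<open>subproblem_stationaryD\<close>). Moreover
  \<open>\<epsilon>\<^sub>k = \<kappa>\<^sub>\<epsilon>\<^sup>k \<epsilon>\<^sub>0\<close> tends to zero because the termination tolerance is zero.

  The update rule for \<open>\<rho>\<close> leaves two possibilities (lemma \<open>parameter_or_violation_tendsto_zero\<close>).
  If \<open>\<rho>\<^sub>k\<close> does not tend to zero, then the constraint violation contracts from some iteration on.
  Hence the limit point is feasible for \<open>c = 0\<close>, the gradient \<open>J\<^sup>T c\<close> vanishes there, and the zero
  multiplier works. If \<open>\<rho>\<^sub>k\<close> tends to zero, multiply the first relation by \<open>\<rho>\<^sub>k\<close> and insert the second:
  the terms with \<open>\<nabla>f\<close>, \<open>yh\<^sub>k\<close> and \<open>\<epsilon>\<^sub>k\<close> disappear in the limit, so that \<open>\<rho>\<^sub>k z\<^sub>k\<close> converges along the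
  subsequence to \<open>- J(x\<^sup>*)\<^sup>T c(x\<^sup>*)\<close>, the required multiplier. It inherits the sign
  \<open>z\<^sub>k \<le> 0\<close> of the barrier derivative. Where a component of \<open>x\<^sup>*\<close> is positive, the
  corresponding barrier derivative stays bounded along the subsequence, and so does \<open>\<mu>\<^sub>k\<close>; the factor \<open>\<rho>\<^sub>k\<close>
  then forces that component of the multiplier to vanish, which is complementarity.
\<close>

section \<open>Gradients and Jacobians of continuously differentiable maps\<close>

lemma GDERIV_componentwise:
  fixes g :: "real^'n \<Rightarrow> real"
  assumes "(g has_derivative g') (at x)"
  shows "GDERIV g x :> (\<chi> i. g' (axis i 1))"
proof -
  have "g' = (\<lambda>h. h \<bullet> (\<chi> i. g' (axis i 1)))"
  proof
    fix h
    have lin: "linear g'"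
      using assms by (rule has_derivative_linear)
    have "g' h = g' (\<Sum>i\<in>UNIV. (h $ i) *\<^sub>R axis i 1)"
      by (simp add: basis_expansion flip: scalar_mult_eq_scaleR)
    also have "\<dots> = h \<bullet> (\<chi> i. g' (axis i 1))"
      by (simp add: linear_sum[OF lin] linear_scale[OF lin] inner_vec_def)
    finally show "g' h = h \<bullet> (\<chi> i. g' (axis i 1))" .
  qed
  with assms show ?thesis
    by (simp add: gderiv_def)
qed

lemma C1_map_imp_differentiable:
  "C1_map g \<Longrightarrow> g differentiable (at x)"
  unfolding C1_map_def differentiable_def by blast

lemma C1_map_imp_isCont:
  "C1_map g \<Longrightarrow> isCont g x"
  by (rule differentiable_imp_continuous_within[OF C1_map_imp_differentiable])

lemma C1_map_GDERIV_gradient: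
  fixes g :: "real^'n \<Rightarrow> real"
  assumes "C1_map g"
  shows "GDERIV g x :> gradient g x"
  using C1_map_imp_differentiable[OF assms, of x] GDERIV_componentwise gradient_eqI
  unfolding differentiable_def by metis

lemma C1_map_isCont_gradient:
  fixes g :: "real^'n \<Rightarrow> real"
  assumes "C1_map g"
  shows "isCont (gradient g) x"
proof -
  obtain g' :: "real^'n \<Rightarrow> (real^'n) \<Rightarrow>\<^sub>L real"
    where g': "\<And>x. (g has_derivative blinfun_apply (g' x)) (at x)" and cont: "continuous_on UNIV g'"
    using assms unfolding C1_map_def by blast
  have "gradient g = (\<lambda>u. \<chi> i. g' u (axis i 1))"
    using gradient_eqI[OF GDERIV_componentwise[OF g']] by blast
  moreover have "continuous_on UNIV (\<lambda>u. \<chi> i. g' u (axis i 1))"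
    by (intro continuous_intros cont)
  ultimately show ?thesis
    by (simp add: continuous_on_eq_continuous_at)
qed

text \<open>
  Continuity is assumed for the derivative as a map into bounded linear functions, whereas the Jacobian is a
  matrix. Component \<open>i\<close> of \<open>J\<^sup>T w\<close> is the inner product of \<open>w\<close> with the derivative in direction \<open>i\<close>,
  and in this form the continuity of the derivative applies.
\<close>

lemma tendsto_transpose_jacobian_mult:
  fixes c :: "real^'n \<Rightarrow> real^'m"
  assumes "C1_map c" and "(u \<longlongrightarrow> u\<^sub>0) F" and "(w \<longlongrightarrow> w\<^sub>0) F"
  shows "((\<lambda>k. transpose (jacobian c (at (u k))) *v w k) \<longlongrightarrow> transpose (jacobian c (at u\<^sub>0)) *v w\<^sub>0) F"
proof -
  obtain c' :: "real^'n \<Rightarrow> (real^'n) \<Rightarrow>\<^sub>L (real^'m)"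
    where c': "\<And>x. (c has_derivative blinfun_apply (c' x)) (at x)" and cont: "continuous_on UNIV c'"
    using assms(1) unfolding C1_map_def by blast
  have eq: "transpose (jacobian c (at v)) *v q = (\<chi> i. q \<bullet> c' v (axis i 1))" for v q
  proof -
    have "transpose (jacobian c (at v)) *v q = adjoint (blinfun_apply (c' v)) q"
      using adjoint_frechet_derivative_eq_transpose_jacobian[OF C1_map_imp_differentiable[OF assms(1)], of v q]
      by (metis c' frechet_derivative_at)
    moreover have "adjoint (blinfun_apply (c' v)) q $ i = q \<bullet> c' v (axis i 1)" for i
      using adjoint_works[OF bounded_linear.linear[OF blinfun.bounded_linear_right], of "axis i 1" "c' v" q]
      by (simp add: inner_axis' inner_commute)
    ultimately show ?thesis
      by (simp add: vec_eq_iff)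
  qed
  have "isCont c' u\<^sub>0"
    using cont by (simp add: continuous_on_eq_continuous_at)
  then have "((\<lambda>k. c' (u k)) \<longlongrightarrow> c' u\<^sub>0) F"
    using assms(2) by (rule isCont_tendsto_compose)
  then show ?thesis
    unfolding eq by (intro tendsto_intros assms(3))
qed

section \<open>The barrier and the stationarity conditions of the subproblems\<close>

definition barrier_gradient :: "('n \<Rightarrow> real \<Rightarrow> ereal) \<Rightarrow> real^'n \<Rightarrow> real^'n" where
  "barrier_gradient b x = (\<chi> i. deriv (\<lambda>t. real_of_ereal (b i t)) (x $ i))"

lemma barrier_finite_iff:
  assumes "barrier b"
  shows "\<bar>b i t\<bar> \<noteq> \<infinity> \<longleftrightarrow> 0 < t"
proof -
  have "b i t \<noteq> - \<infinity>" and "{t. b i t \<noteq> \<infinity>} = {0<..}"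
    using assms unfolding barrier_def by blast+
  then have "b i t \<noteq> \<infinity> \<longleftrightarrow> 0 < t"
    by (metis greaterThan_iff mem_Collect_eq)
  with \<open>b i t \<noteq> - \<infinity>\<close> show ?thesis
    by (cases "b i t") auto
qed

lemma barrier_sum_finite_iff:
  assumes "barrier b"
  shows "\<bar>barrier_sum b x\<bar> \<noteq> \<infinity> \<longleftrightarrow> (\<forall>i. 0 < x $ i)"
  unfolding barrier_sum_def using sum_Inf[of "\<lambda>i. b i (x $ i)" UNIV]
  barrier_finite_iff[OF assms] by auto

lemma barrier_isCont_deriv:
  assumes "barrier b" and "0 < t"
  shows "isCont (deriv (\<lambda>t. real_of_ereal (b i t))) t"
proof -
  have "continuous_on {0<..} (\<lambda>t. vector_derivative (\<lambda>t. real_of_ereal (b i t)) (at t))"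
    using assms(1) by (simp add: barrier_def C1_differentiable_on_eq)
  then have "continuous_on {0<..} (deriv (\<lambda>t. real_of_ereal (b i t)))"
    using field_derivative_eq_vector_derivative[of "\<lambda>t. real_of_ereal (b i t)"] by simp
  with assms(2) show ?thesis
    by (simp add: continuous_on_eq_continuous_at)
qed

lemma open_positive_orthant:
  "open {u :: real^'n. \<forall>i. 0 < u $ i}"
  unfolding Collect_all_eq
  by (intro open_INT ballI open_Collect_less continuous_intros) simp

lemma GDERIV_barrier_sum:
  fixes x :: "real^'n"
  assumes b: "barrier b" and pos: "\<forall>i. 0 < x $ i"
  shows "GDERIV (\<lambda>u. real_of_ereal (barrier_sum b u)) x :> barrier_gradient b x"
proof -
  define \<beta> where "\<beta> i t = real_of_ereal (b i t)" for i t
  have "(\<beta> i has_real_derivative deriv (\<beta> i) (x $ i)) (at (x $ i))" for i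
  proof -
    have "\<beta> i C1_differentiable_on {0<..}"
      using b by (simp add: barrier_def \<beta>_def[abs_def])
    then have "\<beta> i differentiable at (x $ i)"
      using pos by (simp add: C1_differentiable_on_eq)
    then show ?thesis
      by (simp add: DERIV_deriv_iff_real_differentiable)
  qed
  then have "((\<lambda>u. \<beta> i (u $ i)) has_derivative (\<lambda>h. deriv (\<beta> i) (x $ i) * h $ i)) (at x)" for i
    unfolding has_field_derivative_def
    by (rule has_derivative_compose[OF bounded_linear_imp_has_derivative[OF bounded_linear_vec_nth]])
  then have "((\<lambda>u. \<Sum>i\<in>UNIV. \<beta> i (u $ i)) has_derivative (\<lambda>h. \<Sum>i\<in>UNIV. deriv (\<beta> i) (x $ i) * h $ i)) (at x)"
    by (intro has_derivative_sum)
  moreover have "(\<lambda>h. \<Sum>i\<in>UNIV. deriv (\<beta> i) (x $ i) * h $ i) = (\<lambda>h. h \<bullet> barrier_gradient b x)"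
    unfolding inner_vec_def barrier_gradient_def \<beta>_def[abs_def] inner_real_def vec_lambda_beta
    by (simp only: mult.commute)
  ultimately have der: "((\<lambda>u. \<Sum>i\<in>UNIV. \<beta> i (u $ i)) has_derivative (\<lambda>h. h \<bullet> barrier_gradient b x)) (at x)"
    by simp
  have eq: "(\<Sum>i\<in>UNIV. \<beta> i (u $ i)) = real_of_ereal (barrier_sum b u)" if "u \<in> {u. \<forall>i. 0 < u $ i}" for u
    unfolding barrier_sum_def \<beta>_def using that barrier_finite_iff[OF b]
    by (intro sum_real_of_ereal) simp
  show ?thesis
    unfolding gderiv_def
    by (rule has_derivative_transform_within_open[OF der open_positive_orthant _ eq]) (simp add: pos)
qed

text \<open>
  A point where the objective is finite lies in the open positive orthant because
  \<open>\<mu> > 0\<close> keeps the infinite values of the barrier. Near such a point the objective is an ordinary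
  differentiable function with gradient \<open>(\<nabla>f + \<mu> \<nabla>b, \<rho> l)\<close>, and the adjoint of the derivative of the
  constraint maps \<open>y\<close> to \<open>(J\<^sup>T y, - \<rho> y)\<close>. Each block of their sum is bounded by the norm of the pair.
\<close>

lemma subproblem_stationaryD:
  assumes f: "C1_map f" and c: "C1_map c" and b: "barrier b" and "\<mu> > 0"
    and stat: "subproblem_stationary f c b \<rho> \<mu> yh \<epsilon> x l y"
  shows "\<forall>i. 0 < x $ i"
    and "norm (gradient f x + transpose (jacobian c (at x)) *v y + \<mu> *\<^sub>R barrier_gradient b x) \<le> \<epsilon>"
    and "norm (\<rho> *\<^sub>R (l - y)) \<le> \<epsilon>"
    and "norm (c x + \<rho> *\<^sub>R (yh - l)) \<le> \<epsilon>"
proof -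
  let ?B = "\<lambda>u. real_of_ereal (barrier_sum b u)"
  let ?J = "frechet_derivative c (at x)"
  have fin: "\<bar>sub_objective f b \<rho> \<mu> (x, l)\<bar> \<noteq> \<infinity>"
    and grad: "norm (gradient (\<lambda>v. real_of_ereal (sub_objective f b \<rho> \<mu> v)) (x, l)
      + adjoint (frechet_derivative (sub_constraint c \<rho> yh) (at (x, l))) y) \<le> \<epsilon>"
    and con: "norm (sub_constraint c \<rho> yh (x, l)) \<le> \<epsilon>"
    using stat unfolding subproblem_stationary_def eq_KKT_stationary_def by auto
  show "norm (c x + \<rho> *\<^sub>R (yh - l)) \<le> \<epsilon>"
    using con by (simp add: sub_constraint_def)
  have "\<bar>barrier_sum b x\<bar> \<noteq> \<infinity>"
    using fin \<open>\<mu> > 0\<close> by (cases "barrier_sum b x") (simp_all add: sub_objective_def)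
  then show pos: "\<forall>i. 0 < x $ i"
    by (rule iffD1[OF barrier_sum_finite_iff[OF b]])
  have split: "f (fst v) + \<rho> / 2 * (snd v \<bullet> snd v) + \<mu> * ?B (fst v)
      = real_of_ereal (sub_objective f b \<rho> \<mu> v)" if "\<forall>i. 0 < fst v $ i" for v
    using barrier_sum_finite_iff[OF b, of "fst v"] that
    by (cases "barrier_sum b (fst v)") (simp_all add: sub_objective_def split_beta power2_norm_eq_inner)
  have fst_d: "(fst has_derivative fst) (at (x, l))" and snd_d: "(snd has_derivative snd) (at (x, l))"
    by (simp_all add: bounded_linear_imp_has_derivative bounded_linear_fst bounded_linear_snd)
  have Bd: "(?B has_derivative (\<lambda>h. h \<bullet> barrier_gradient b x)) (at (fst (x, l)))"
    and fd: "(f has_derivative (\<lambda>h. h \<bullet> gradient f x)) (at (fst (x, l)))"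
    using C1_map_GDERIV_gradient[OF f, of x] GDERIV_barrier_sum[OF b pos] unfolding gderiv_def by simp_all
  have "((\<lambda>v. f (fst v) + \<rho> / 2 * (snd v \<bullet> snd v) + \<mu> * ?B (fst v)) has_derivative
      (\<lambda>h. fst h \<bullet> gradient f x + \<rho> / 2 * (l \<bullet> snd h + snd h \<bullet> l) + \<mu> * (fst h \<bullet> barrier_gradient b x)))
      (at (x, l))"
    using has_derivative_add[OF has_derivative_add[OF has_derivative_compose[OF fst_d fd]
        has_derivative_mult_right[OF has_derivative_inner[OF snd_d snd_d], of "\<rho> / 2"]]
        has_derivative_mult_right[OF has_derivative_compose[OF fst_d Bd], of \<mu>]]
    by simp
  moreover have "(\<lambda>h. fst h \<bullet> gradient f x + \<rho> / 2 * (l \<bullet> snd h + snd h \<bullet> l) + \<mu> * (fst h \<bullet> barrier_gradient b x))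
      = (\<lambda>h. h \<bullet> (gradient f x + \<mu> *\<^sub>R barrier_gradient b x, \<rho> *\<^sub>R l))"
    by (auto simp: fun_eq_iff inner_prod_def inner_commute algebra_simps)
  ultimately have der: "((\<lambda>v. f (fst v) + \<rho> / 2 * (snd v \<bullet> snd v) + \<mu> * ?B (fst v)) has_derivative
      (\<lambda>h. h \<bullet> (gradient f x + \<mu> *\<^sub>R barrier_gradient b x, \<rho> *\<^sub>R l))) (at (x, l))"
    by simp
  have "GDERIV (\<lambda>v. real_of_ereal (sub_objective f b \<rho> \<mu> v)) (x, l)
      :> (gradient f x + \<mu> *\<^sub>R barrier_gradient b x, \<rho> *\<^sub>R l)"
    unfolding gderiv_def
    by (rule has_derivative_transform_within_open[OF der open_vimage_fst[OF open_positive_orthant]])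
      (simp add: pos, rule split, simp)
  then have gr: "gradient (\<lambda>v. real_of_ereal (sub_objective f b \<rho> \<mu> v)) (x, l)
      = (gradient f x + \<mu> *\<^sub>R barrier_gradient b x, \<rho> *\<^sub>R l)"
    by (rule gradient_eqI)
  have dc: "(c has_derivative ?J) (at x)"
    using C1_map_imp_differentiable[OF c] frechet_derivative_works by blast
  then have dc': "(c has_derivative ?J) (at (fst (x, l)))"
    by simp
  have "(sub_constraint c \<rho> yh has_derivative (\<lambda>h. ?J (fst h) - \<rho> *\<^sub>R snd h)) (at (x, l))"
    unfolding sub_constraint_def split_beta
    using has_derivative_add[OF has_derivative_compose[OF fst_d dc']
        has_derivative_scaleR_right[OF has_derivative_diff[OF has_derivative_const snd_d], of \<rho> yh]]
    by simp
  then have "frechet_derivative (sub_constraint c \<rho> yh) (at (x, l)) = (\<lambda>h. ?J (fst h) - \<rho> *\<^sub>R snd h)"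
    by (rule frechet_derivative_at[symmetric])
  moreover have "adjoint (\<lambda>h. ?J (fst h) - \<rho> *\<^sub>R snd h) = (\<lambda>q. (adjoint ?J q, - \<rho> *\<^sub>R q))"
  proof (rule adjoint_unique, intro allI)
    fix h :: "(real^'a) \<times> (real^'b)" and q :: "real^'b"
    have "(?J (fst h) - \<rho> *\<^sub>R snd h) \<bullet> q = fst h \<bullet> adjoint ?J q - \<rho> * (snd h \<bullet> q)"
      unfolding inner_diff_left inner_scaleR_left
      by (simp only: adjoint_works[OF has_derivative_linear[OF dc]])
    then show "(?J (fst h) - \<rho> *\<^sub>R snd h) \<bullet> q = h \<bullet> (adjoint ?J q, - \<rho> *\<^sub>R q)"
      by (simp only: inner_prod_def fst_conv snd_conv inner_scaleR_right)
  qed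
  ultimately have "adjoint (frechet_derivative (sub_constraint c \<rho> yh) (at (x, l))) y
      = (transpose (jacobian c (at x)) *v y, - \<rho> *\<^sub>R y)"
    by (simp add: adjoint_frechet_derivative_eq_transpose_jacobian C1_map_imp_differentiable[OF c])
  with grad gr have n: "norm (gradient f x + transpose (jacobian c (at x)) *v y + \<mu> *\<^sub>R barrier_gradient b x,
      \<rho> *\<^sub>R (l - y)) \<le> \<epsilon>"
    by (simp add: algebra_simps)
  show "norm (gradient f x + transpose (jacobian c (at x)) *v y + \<mu> *\<^sub>R barrier_gradient b x) \<le> \<epsilon>"
    using norm_fst_le n by (rule order_trans)
  show "norm (\<rho> *\<^sub>R (l - y)) \<le> \<epsilon>"
    using norm_snd_le n by (rule order_trans)
qed

section \<open>The effect of the parameter updates\<close>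

lemma tendsto_zero_of_eventual_contraction:
  fixes C :: "nat \<Rightarrow> real"
  assumes "0 \<le> \<theta>" "\<theta> < 1" and nonneg: "\<And>k. 0 \<le> C k"
    and ev: "\<forall>\<^sub>F k in sequentially. C (Suc k) \<le> \<theta> * C k"
  shows "C \<longlonglongrightarrow> 0"
proof -
  obtain N where N: "\<And>k. k \<ge> N \<Longrightarrow> C (Suc k) \<le> \<theta> * C k"
    using ev unfolding eventually_sequentially by blast
  have "C (k + N) \<le> \<theta> ^ k * C N" for k
  proof (induction k)
    case (Suc k)
    have "C (Suc k + N) \<le> \<theta> * C (k + N)"
      using N[of "k + N"] by simp
    also have "\<dots> \<le> \<theta> * (\<theta> ^ k * C N)"
      using Suc \<open>0 \<le> \<theta>\<close> by (rule mult_left_mono)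
    finally show ?case by simp
  qed simp
  moreover have "(\<lambda>k. \<theta> ^ k * C N) \<longlonglongrightarrow> 0"
    using assms(1,2) by (intro tendsto_mult_left_zero LIMSEQ_power_zero) simp
  ultimately have "(\<lambda>k. C (k + N)) \<longlonglongrightarrow> 0"
    using nonneg by - (rule real_tendsto_sandwich[OF always_eventually always_eventually tendsto_const], auto)
  then show ?thesis
    by (rule LIMSEQ_offset)
qed

lemma parameter_updates_pos_decseq:
  fixes p :: "nat \<Rightarrow> real"
  assumes "0 < p 0" and "\<kappa> < 1"
    and step: "\<And>k. p (Suc k) = p k \<or> p (Suc k) \<in> {0<..\<kappa> * p k}"
  shows "0 < p k" and "decseq p"
proof -
  show pos: "0 < p k" for k
  proof (induction k)
    case (Suc k)
    then show ?case
      using step[of k] by auto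
  qed fact
  show "decseq p"
  proof (rule decseq_SucI)
    fix k
    have "\<kappa> * p k \<le> p k"
      using pos[of k] \<open>\<kappa> < 1\<close> by simp
    then show "p (Suc k) \<le> p k"
      using step[of k] by auto
  qed
qed

text \<open>
  If a decreasing positive sequence has a limit \<open>L > 0\<close>, then \<open>\<kappa> * p k\<close> eventually drops below \<open>L\<close>,
  so a further reduction by the factor \<open>\<kappa>\<close> would jump below the limit. From then on only
  the other alternative of the update remains, and the violation contracts geometrically.
\<close>

lemma parameter_or_violation_tendsto_zero:
  fixes p C :: "nat \<Rightarrow> real"
  assumes pos: "\<And>k. 0 < p k" and dec: "decseq p" and "\<kappa> < 1"
    and \<theta>: "0 \<le> \<theta>" "\<theta> < 1" and nonneg: "\<And>k. 0 \<le> C k"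
    and update: "\<And>k. C (Suc k) \<le> \<theta> * C k \<or> p (Suc (Suc k)) \<le> \<kappa> * p (Suc k)"
  shows "p \<longlonglongrightarrow> 0 \<or> C \<longlonglongrightarrow> 0"
proof -
  obtain L where L: "p \<longlonglongrightarrow> L" "\<And>k. L \<le> p k"
    using decseq_convergent[OF dec, of 0] pos less_imp_le by metis
  have "C \<longlonglongrightarrow> 0" if "L \<noteq> 0"
  proof -
    have "0 \<le> L"
      using L(1) pos less_imp_le by (metis LIMSEQ_le_const)
    with that \<open>\<kappa> < 1\<close> have "\<kappa> * L < L"
      by simp
    moreover have "(\<lambda>k. \<kappa> * p k) \<longlonglongrightarrow> \<kappa> * L"
      by (intro tendsto_intros L)
    ultimately have "\<forall>\<^sub>F k in sequentially. \<kappa> * p k < L"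
      by (metis order_tendstoD(2))
    then have "\<forall>\<^sub>F k in sequentially. \<kappa> * p (Suc k) < L"
      by (rule eventually_compose_filterlim[OF _ filterlim_Suc])
    then have "\<forall>\<^sub>F k in sequentially. C (Suc k) \<le> \<theta> * C k"
    proof eventually_elim
      case (elim k)
      then show ?case
        using update[of k] L(2)[of "Suc (Suc k)"] by linarith
    qed
    then show ?thesis
      using \<theta> nonneg by (intro tendsto_zero_of_eventual_contraction)
  qed
  then show ?thesis
    using L(1) by blast
qed

section \<open>Limit points are stationary for the infeasibility measure\<close>

theorem proposition4p4:
  fixes f :: "real^'n \<Rightarrow> real"
    and c :: "real^'n \<Rightarrow> real^'m"
    and b :: "'n \<Rightarrow> real \<Rightarrow> ereal"
    and \<kappa>\<^sub>\<rho> \<kappa>\<^sub>\<mu> \<kappa>\<^sub>\<epsilon> \<theta>\<^sub>\<rho> \<theta>\<^sub>\<mu> :: real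
    and Y :: "(real^'m) set"
    and \<rho> \<mu> \<epsilon> :: "nat \<Rightarrow> real"
    and x z :: "nat \<Rightarrow> real^'n"
    and yh l y :: "nat \<Rightarrow> real^'m"
    and r :: "nat \<Rightarrow> nat"
    and xs :: "real^'n"
  assumes "C1_map f" and "C1_map c"
    and "barrier b"
    and "subproblems_well_posed f c b (\<rho> 0) (\<mu> 0) Y"
    and "regularized_ip_run f c b 0 \<kappa>\<^sub>\<rho> \<kappa>\<^sub>\<mu> \<kappa>\<^sub>\<epsilon> \<theta>\<^sub>\<rho> \<theta>\<^sub>\<mu> Y \<rho> \<mu> \<epsilon> yh x l y z"
    and "strict_mono r" and "(x \<circ> r) \<longlonglongrightarrow> xs"
  shows "\<exists>zs :: real^'n.
           transpose (jacobian c (at xs)) *v c xs + zs = 0 \<and>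
           (\<forall>i. xs $ i \<ge> 0) \<and>
           (\<forall>i. zs $ i \<le> 0) \<and>
           (\<forall>i. min (xs $ i) (- (zs $ i)) = 0)"
proof -
  interpret regularized_ip_run f c b 0 \<kappa>\<^sub>\<rho> \<kappa>\<^sub>\<mu> \<kappa>\<^sub>\<epsilon> \<theta>\<^sub>\<rho> \<theta>\<^sub>\<mu> Y \<rho> \<mu> \<epsilon> yh x l y z
    by fact
  let ?J = "\<lambda>u. transpose (jacobian c (at u))"
  have xr: "(\<lambda>k. x (r k)) \<longlonglongrightarrow> xs"
    using assms(7) by (simp add: o_def)
  have \<rho>_step: "\<rho> (Suc k) = \<rho> k \<or> \<rho> (Suc k) \<in> {0<..\<kappa>\<^sub>\<rho> * \<rho> k}" for k
    using rho_update[rule_format, of k] by metis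
  have \<mu>_step: "\<mu> (Suc k) = \<mu> k \<or> \<mu> (Suc k) \<in> {0<..\<kappa>\<^sub>\<mu> * \<mu> k}" for k
    using mu_update[rule_format, of k] by metis
  have \<kappa>: "\<kappa>\<^sub>\<rho> < 1" "\<kappa>\<^sub>\<mu> < 1"
    using kappa by simp_all
  note \<rho>_pos = parameter_updates_pos_decseq(1)[of \<rho>, OF initial_pos(2) \<kappa>(1) \<rho>_step]
    and \<mu>_pos = parameter_updates_pos_decseq(1)[of \<mu>, OF initial_pos(3) \<kappa>(2) \<mu>_step]
  have \<rho>_dec: "decseq \<rho>"
    by (rule parameter_updates_pos_decseq(2)[of \<rho>, OF initial_pos(2) \<kappa>(1) \<rho>_step])
  have \<mu>_le: "\<mu> k \<le> \<mu> 0" for k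
    using parameter_updates_pos_decseq(2)[of \<mu>, OF initial_pos(3) \<kappa>(2) \<mu>_step] by (simp add: decseqD)
  have dichotomy: "\<rho> \<longlonglongrightarrow> 0 \<or> (\<lambda>k. norm (c (x k))) \<longlonglongrightarrow> 0"
  proof (rule parameter_or_violation_tendsto_zero[OF \<rho>_pos \<rho>_dec \<kappa>(1)])
    show "0 \<le> \<theta>\<^sub>\<rho>" "\<theta>\<^sub>\<rho> < 1"
      using theta by simp_all
    then have "max 0 (\<theta>\<^sub>\<rho> * norm (c (x k))) = \<theta>\<^sub>\<rho> * norm (c (x k))" for k
      by simp
    then show "norm (c (x (Suc k))) \<le> \<theta>\<^sub>\<rho> * norm (c (x k)) \<or> \<rho> (Suc (Suc k)) \<le> \<kappa>\<^sub>\<rho> * \<rho> (Suc k)" for k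
      using rho_update[rule_format, of "Suc k"] by (cases "norm (c (x (Suc k))) \<le> \<theta>\<^sub>\<rho> * norm (c (x k))") simp_all
  qed simp
  note stationary = subproblem_stationaryD[OF assms(1,2,3) \<mu>_pos subproblem[rule_format]]
  have pos: "0 < x k $ i" for k i
    using stationary(1) by simp
  have z: "z k = \<mu> k *\<^sub>R barrier_gradient b (x k)" for k
    using gradient_eqI[OF GDERIV_barrier_sum[OF assms(3) stationary(1)]] z_eq by simp
  have z_nonpos: "z k $ i \<le> 0" for k i
    using assms(3) pos \<mu>_pos[of k]
    by (simp add: z barrier_def barrier_gradient_def mult_le_0_iff)
  have xs_nonneg: "0 \<le> xs $ i" for i
    using pos by (intro LIMSEQ_le_const[OF tendsto_vec_nth[OF xr]]) (simp add: less_imp_le)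
  have "\<epsilon> = (\<lambda>k. \<kappa>\<^sub>\<epsilon> ^ k * \<epsilon> 0)"
  proof
    fix k
    have "\<epsilon> k = \<kappa>\<^sub>\<epsilon> ^ k * \<epsilon> 0 \<and> 0 \<le> \<epsilon> k"
      using eps_update initial_pos kappa by (induction k) simp_all
    then show "\<epsilon> k = \<kappa>\<^sub>\<epsilon> ^ k * \<epsilon> 0" ..
  qed
  moreover have "(\<lambda>k. \<kappa>\<^sub>\<epsilon> ^ k * \<epsilon> 0) \<longlonglongrightarrow> 0"
    using kappa by (intro tendsto_mult_left_zero LIMSEQ_power_zero) simp
  ultimately have eps: "(\<lambda>k. \<epsilon> (r k)) \<longlonglongrightarrow> 0"
    by (simp add: filterlim_compose[OF _ filterlim_subseq[OF \<open>strict_mono r\<close>]])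
  have cr: "(\<lambda>k. c (x (r k))) \<longlonglongrightarrow> c xs"
    by (rule isCont_tendsto_compose[OF C1_map_imp_isCont[OF assms(2)] xr])
  show ?thesis
  proof (cases "\<rho> \<longlonglongrightarrow> 0")
    case False
    with dichotomy have "(\<lambda>k. norm (c (x k))) \<longlonglongrightarrow> 0"
      by blast
    then have "(\<lambda>k. norm (c (x (r k)))) \<longlonglongrightarrow> 0"
      by (rule filterlim_compose[OF _ filterlim_subseq[OF \<open>strict_mono r\<close>]])
    then have "c xs = 0"
      using LIMSEQ_unique[OF cr] by (simp add: tendsto_norm_zero_iff)
    then show ?thesis
      using xs_nonneg by (intro exI[of _ 0]) auto
  next
    case True
    then have \<rho>r: "(\<lambda>k. \<rho> (r k)) \<longlonglongrightarrow> 0"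
      by (rule filterlim_compose[OF _ filterlim_subseq[OF \<open>strict_mono r\<close>]])
    (* s is the residual of stationarity in x; t is that of the constraint with l replaced by y, which
       the stationarity in l permits at the cost of another epsilon. *)
    define s where "s k = gradient f (x k) + ?J (x k) *v y k + z k" for k
    define t where "t k = c (x k) + \<rho> k *\<^sub>R (yh k - y k)" for k
    have s: "(\<lambda>k. s (r k)) \<longlonglongrightarrow> 0"
      using stationary(2) by - (rule Lim_null_comparison[OF always_eventually eps], simp add: s_def z)
    have t_le: "norm (t k) \<le> 2 * \<epsilon> k" for k
    proof -
      have "t k = (c (x k) + \<rho> k *\<^sub>R (yh k - l k)) + \<rho> k *\<^sub>R (l k - y k)"
        by (simp add: t_def algebra_simps)
      then show ?thesis
        using norm_triangle_mono[OF stationary(4)[of k] stationary(3)[of k]] by simp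
    qed
    have t: "(\<lambda>k. t (r k)) \<longlonglongrightarrow> 0"
      using tendsto_mult_right_zero[OF eps, of 2] t_le
      by - (rule Lim_null_comparison[OF always_eventually, of _ "\<lambda>k. 2 * \<epsilon> (r k)"], auto)
    obtain M where M: "\<And>k. norm (yh k) \<le> M"
      using Y(2) yh_in unfolding bounded_iff by blast
    have yh0: "(\<lambda>k. \<rho> (r k) *\<^sub>R yh (r k)) \<longlonglongrightarrow> 0"
      using tendsto_mult_left_zero[OF \<rho>r, of M] M \<rho>_pos less_imp_le[OF \<rho>_pos]
      by - (rule Lim_null_comparison[OF always_eventually, of _ "\<lambda>k. \<rho> (r k) * M"], auto intro: mult_left_mono)
    have grad: "(\<lambda>k. gradient f (x (r k))) \<longlonglongrightarrow> gradient f xs"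
      by (rule isCont_tendsto_compose[OF C1_map_isCont_gradient[OF assms(1)] xr])
    (* The possibly unbounded multipliers y enter only through \<rho> k *\<^sub>R y k, which t expresses by
       convergent quantities. *)
    have "\<rho> k *\<^sub>R z k = \<rho> k *\<^sub>R s k - \<rho> k *\<^sub>R gradient f (x k)
        - ?J (x k) *v (c (x k) + \<rho> k *\<^sub>R yh k - t k)" for k
    proof -
      have "c (x k) + \<rho> k *\<^sub>R yh k - t k = \<rho> k *\<^sub>R y k"
        by (simp add: t_def algebra_simps)
      then show ?thesis
        by (simp add: s_def matrix_vector_mult_scaleR algebra_simps)
    qed
    moreover have "(\<lambda>k. \<rho> (r k) *\<^sub>R s (r k) - \<rho> (r k) *\<^sub>R gradient f (x (r k))
        - ?J (x (r k)) *v (c (x (r k)) + \<rho> (r k) *\<^sub>R yh (r k) - t (r k)))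
        \<longlonglongrightarrow> 0 *\<^sub>R 0 - 0 *\<^sub>R gradient f xs - ?J xs *v (c xs + 0 - 0)"
      by (intro tendsto_intros tendsto_transpose_jacobian_mult assms(2) xr s t \<rho>r yh0 grad cr)
    ultimately have zr: "(\<lambda>k. \<rho> (r k) *\<^sub>R z (r k)) \<longlonglongrightarrow> - (?J xs *v c xs)"
      by simp
    let ?zs = "- (?J xs *v c xs)"
    have lim_i: "(\<lambda>k. \<rho> (r k) * z (r k) $ i) \<longlonglongrightarrow> ?zs $ i" for i
      using tendsto_vec_nth[OF zr, of i] by simp
    have nonpos: "?zs $ i \<le> 0" for i
      using z_nonpos \<rho>_pos
      by (intro LIMSEQ_le_const2[OF lim_i]) (auto simp: mult_le_0_iff less_imp_le)
    moreover have "?zs $ i = 0" if "0 < xs $ i" for i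
    proof -
      let ?d = "deriv (\<lambda>t. real_of_ereal (b i t))"
      have d: "(\<lambda>k. ?d (x (r k) $ i)) \<longlonglongrightarrow> ?d (xs $ i)"
        by (rule isCont_tendsto_compose[OF barrier_isCont_deriv[OF assms(3) that] tendsto_vec_nth[OF xr]])
      have "(\<lambda>k. \<rho> (r k) * \<mu> (r k)) \<longlonglongrightarrow> 0"
        using tendsto_mult_left_zero[OF \<rho>r, of "\<mu> 0"] \<mu>_le \<mu>_pos \<rho>_pos
        by - (rule Lim_null_comparison[OF always_eventually, of _ "\<lambda>k. \<rho> (r k) * \<mu> 0"],
          auto simp: less_imp_le abs_of_pos intro: mult_left_mono)
      from tendsto_mult[OF this d] have "(\<lambda>k. \<rho> (r k) * z (r k) $ i) \<longlonglongrightarrow> 0"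
        by (simp add: z barrier_gradient_def mult.assoc)
      with lim_i show ?thesis
        using LIMSEQ_unique by blast
    qed
    ultimately have "min (xs $ i) (- (?zs $ i)) = 0" for i
      using xs_nonneg[of i] nonpos[of i] by (cases "xs $ i = 0") (auto simp: min_def)
    then show ?thesis
      using nonpos xs_nonneg by (intro exI[of _ ?zs]) simp
  qed
qed

end
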